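(* Suppose that $A_0$ and $A_1$ are jointly positive definite, that is, there exists $\mu_1\in\mathbb{R}$ such that $A_0+\mu_1A_1\succ 0$. Then the following statements are true. (i) If $A_1$ is semidefinite, i.e. $A_1\succeq 0$ or $A_1\preceq 0$, then the problem (GTRE) has at most one local-nonglobal minimizer. (ii) If $A_1$ is indefinite, i.e. there exist $\bar x,\tilde x\in\mathbb{R}^n$ such that $\bar x^TA_1\bar x<0<\tilde x^TA_1\tilde x$, then the problem (GTRE) has at most two local-nonglobal minimizers.
   Context: Let $A_0,A_1$ be real symmetric $n\times n$ matrices, $b_0,b_1\in\mathbb{R}^n$, $c_1\in\mathbb{R}$, $f_0(x)=x^TA_0x+2b_0^Tx$, $f_1(x)=x^TA_1x+2b_1^Tx+c_1$. Problem (GTRE) is: minimize $f_0(x)$ over $x\in\mathbb{R}^n$ subject to $f_1(x)=0$. A local-nonglobal minimizer is a feasible point that is a local minimizer but not a global minimizer (a global minimizer being a feasible point whose objective value is at most that of every feasible point). *)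

theory Defs
  imports "HOL-Analysis.Analysis"
begin

definition quad_fun :: "real^'n^'n \<Rightarrow> real^'n \<Rightarrow> real \<Rightarrow> real^'n \<Rightarrow> real" where
  "quad_fun A b c x = x \<bullet> (A *v x) + 2 * (b \<bullet> x) + c"

definition symmetric_matrix :: "real^'n^'n \<Rightarrow> bool" where
  "symmetric_matrix A \<longleftrightarrow> transpose A = A"

definition positive_definite :: "real^'n^'n \<Rightarrow> bool" where
  "positive_definite A \<longleftrightarrow> symmetric_matrix A \<and> (\<forall>x. x \<noteq> 0 \<longrightarrow> x \<bullet> (A *v x) > 0)"

definition positive_semidefinite :: "real^'n^'n \<Rightarrow> bool" where
  "positive_semidefinite A \<longleftrightarrow> symmetric_matrix A \<and> (\<forall>x. x \<bullet> (A *v x) \<ge> 0)"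

definition negative_semidefinite :: "real^'n^'n \<Rightarrow> bool" where
  "negative_semidefinite A \<longleftrightarrow> symmetric_matrix A \<and> (\<forall>x. x \<bullet> (A *v x) \<le> 0)"

definition indefinite :: "real^'n^'n \<Rightarrow> bool" where
  "indefinite A \<longleftrightarrow> symmetric_matrix A \<and> (\<exists>x y. x \<bullet> (A *v x) < 0 \<and> 0 < y \<bullet> (A *v y))"

definition global_minimizer :: "('a \<Rightarrow> real) \<Rightarrow> 'a set \<Rightarrow> 'a \<Rightarrow> bool" where
  "global_minimizer f S x \<longleftrightarrow> x \<in> S \<and> (\<forall>y\<in>S. f x \<le> f y)"

definition local_minimizer :: "('a::metric_space \<Rightarrow> real) \<Rightarrow> 'a set \<Rightarrow> 'a \<Rightarrow> bool" where
  "local_minimizer f S x \<longleftrightarrow>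
     x \<in> S \<and> (\<exists>\<epsilon>>0. \<forall>y\<in>S. dist y x < \<epsilon> \<longrightarrow> f x \<le> f y)"

definition local_nonglobal_minimizer :: "('a::metric_space \<Rightarrow> real) \<Rightarrow> 'a set \<Rightarrow> 'a \<Rightarrow> bool" where
  "local_nonglobal_minimizer f S x \<longleftrightarrow> local_minimizer f S x \<and> \<not> global_minimizer f S x"

text \<open>The problem (GTRE): minimize \<open>f\<^sub>0(x) = x\<^sup>T A\<^sub>0 x + 2 b\<^sub>0\<^sup>T x\<close> (no constant term) subject to
  \<open>f\<^sub>1(x) = x\<^sup>T A\<^sub>1 x + 2 b\<^sub>1\<^sup>T x + c\<^sub>1 = 0\<close>.\<close>

definition gtre_objective :: "real^'n^'n \<Rightarrow> real^'n \<Rightarrow> real^'n \<Rightarrow> real" where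
  "gtre_objective A0 b0 = quad_fun A0 b0 0"

definition gtre_feasible :: "real^'n^'n \<Rightarrow> real^'n \<Rightarrow> real \<Rightarrow> (real^'n) set" where
  "gtre_feasible A1 b1 c1 = {x. quad_fun A1 b1 c1 x = 0}"

definition gtre_local_nonglobal_minimizers ::
  "real^'n^'n \<Rightarrow> real^'n \<Rightarrow> real^'n^'n \<Rightarrow> real^'n \<Rightarrow> real \<Rightarrow> (real^'n) set" where
  "gtre_local_nonglobal_minimizers A0 b0 A1 b1 c1 =
     {x. local_nonglobal_minimizer (gtre_objective A0 b0) (gtre_feasible A1 b1 c1) x}"

text \<open>Finiteness is explicit because \<open>card\<close> of an infinite set is \<open>0\<close>.\<close>

definition has_at_most :: "nat \<Rightarrow> 'a set \<Rightarrow> bool" where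
  "has_at_most k S \<longleftrightarrow> finite S \<and> card S \<le> k"

end

theory Submission
  imports Defs
begin

text \<open>
  Write \<open>g = A1 x + b1\<close> for half the constraint gradient at a feasible point \<open>x\<close>.

  A local-nonglobal minimizer has \<open>g \<noteq> 0\<close>: if \<open>g = 0\<close>, the feasible set is a cone with apex \<open>x\<close>,
  and the objective is convex along each of its lines because the objective matrix is positive
  definite on the null vectors of \<open>A1\<close>; hence local minimality at the apex is global.
  So there is a Lagrange multiplier \<open>\<mu>\<close>, and the Hessian \<open>H\<^sub>\<mu> = A0 + \<mu> A1\<close> is nonnegative
  on the tangent space \<open>g\<^sup>\<bottom>\<close>. It is not nonnegative everywhere, for
  the objective changes by exactly \<open>d \<bullet> H\<^sub>\<mu> d\<close> between \<open>x\<close> and a feasible point \<open>x + d\<close>, and some feasible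
  point has a smaller value. These three properties of \<open>(x, \<mu>)\<close> are collected in \<open>saddle_multiplier\<close>; lemma
  \<open>local_nonglobal_minimizer_saddle_multiplier\<close> derives them.

  Let \<open>A0 + \<kappa> A1\<close> be positive definite, so that \<open>\<mu> \<noteq> \<kappa>\<close>. The heart of the matter is
  \<open>saddle_multiplier_unique_above\<close>: there is at most one such \<open>x\<close> with \<open>\<mu> > \<kappa>\<close>.
  Suppose that \<open>x\<close> and \<open>y = x + d\<close> have multipliers \<open>\<kappa> < \<mu> < \<nu>\<close>. Subtracting the two stationarity
  equations shows that \<open>H\<^sub>\<mu> d\<close> is a nonzero multiple of the constraint gradient at \<open>y\<close>, so that
  the tangent space at \<open>y\<close> is the \<open>H\<^sub>\<mu>\<close>-orthogonal complement of \<open>d\<close>. Feasibility of both points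
  makes \<open>d \<bullet> H\<^sub>\<mu> d\<close> positive, so \<open>H\<^sub>\<mu>\<close>, which is negative somewhere, is negative at some
  \<open>w\<close> in that complement. But \<open>H\<^sub>\<nu>\<close> is nonnegative at \<open>w\<close>. Thus the affine function
  \<open>t \<mapsto> w \<bullet> H\<^sub>t w\<close> is positive at \<open>\<kappa>\<close>, negative at \<open>\<mu>\<close> and nonnegative at \<open>\<nu>\<close>, which is absurd.
  If \<open>\<mu> = \<nu>\<close>, then \<open>d\<close> lies in the kernel of \<open>H\<^sub>\<mu>\<close> but not in the tangent space at \<open>x\<close>, so every
  vector can be moved into the tangent space along \<open>d\<close> without changing the form \<open>H\<^sub>\<mu>\<close>, and
  \<open>H\<^sub>\<mu>\<close> would be nonnegative everywhere.

  Changing the sign of the constraint gives the same for multipliers below \<open>\<kappa>\<close>, so there are at most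
  two local-nonglobal minimizers. If \<open>A1\<close> is semidefinite, \<open>H\<^sub>\<mu>\<close> stays positive definite on one side
  of \<open>\<kappa>\<close>, and only the other side can contribute.
\<close>

section \<open>Quadratic functions\<close>

lemma symmetric_matrix_inner_commute:
  fixes A :: "real^'n^'n"
  assumes "symmetric_matrix A"
  shows "u \<bullet> (A *v v) = v \<bullet> (A *v u)"
  using assms unfolding symmetric_matrix_def
  by (metis dot_lmul_matrix inner_commute transpose_matrix_vector)

lemma quad_fun_add:
  fixes A :: "real^'n^'n"
  assumes "symmetric_matrix A"
  shows "quad_fun A b c (x + d) = quad_fun A b c x + 2 * ((A *v x + b) \<bullet> d) + d \<bullet> (A *v d)"
  using symmetric_matrix_inner_commute[OF assms, of d x]
  by (simp add: quad_fun_def matrix_vector_right_distrib inner_add_left inner_add_right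
      inner_commute[of d "A *v x"] algebra_simps)

lemma symmetric_matrix_uminus: "symmetric_matrix A \<Longrightarrow> symmetric_matrix (- A)"
  for A :: "real^'n^'n"
  by (simp add: symmetric_matrix_def transpose_def vec_eq_iff)

lemma inner_uminus_matrix: "u \<bullet> ((- A) *v v) = - (u \<bullet> (A *v v))"
  for A :: "real^'n^'n"
  by (simp add: matrix_vector_mult_def inner_vec_def sum_negf)

lemma uminus_matrix_vector: "(- A) *v v = - (A *v v)"
  for A :: "real^'n^'n"
  by (simp add: matrix_vector_mult_def vec_eq_iff sum_negf)

lemma quad_fun_uminus: "quad_fun (- A) (- b) (- c) x = - quad_fun A b c x"
  by (simp add: quad_fun_def inner_uminus_matrix)

section \<open>Necessary conditions at a local minimizer\<close>

lemma local_minimizer_displacement: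
  fixes A0 A1 :: "real^'n^'n"
  assumes s0: "symmetric_matrix A0" and s1: "symmetric_matrix A1"
    and lm: "local_minimizer (quad_fun A0 b0 c0) {x. quad_fun A1 b1 c1 x = 0} x"
  obtains e where "e > 0"
    "\<And>d. norm d < e \<Longrightarrow> 2 * ((A1 *v x + b1) \<bullet> d) + d \<bullet> (A1 *v d) = 0 \<Longrightarrow>
       0 \<le> 2 * ((A0 *v x + b0) \<bullet> d) + d \<bullet> (A0 *v d)"
proof -
  obtain e where e: "e > 0" and fx: "quad_fun A1 b1 c1 x = 0"
    and min: "\<And>y. quad_fun A1 b1 c1 y = 0 \<Longrightarrow> dist y x < e \<Longrightarrow>
      quad_fun A0 b0 c0 x \<le> quad_fun A0 b0 c0 y"
    using lm unfolding local_minimizer_def by auto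
  show ?thesis
  proof (rule that[OF e])
    fix d :: "real^'n"
    assume "norm d < e" and "2 * ((A1 *v x + b1) \<bullet> d) + d \<bullet> (A1 *v d) = 0"
    then have "quad_fun A0 b0 c0 x \<le> quad_fun A0 b0 c0 (x + d)"
      using fx by (intro min) (simp_all add: quad_fun_add[OF s1] dist_norm)
    then show "0 \<le> 2 * ((A0 *v x + b0) \<bullet> d) + d \<bullet> (A0 *v d)"
      by (simp add: quad_fun_add[OF s0])
  qed
qed

text \<open>If the quadric contains the whole line through the minimizer in direction \<open>v\<close>, the objective
  restricted to this line is a one-variable quadratic with a local minimum at \<open>0\<close>.\<close>

lemma local_minimizer_along_line:
  fixes p v :: "real^'n" and A0 A1 :: "real^'n^'n"
  assumes e: "e > 0"
    and min: "\<And>d. norm d < e \<Longrightarrow> 2 * (g \<bullet> d) + d \<bullet> (A1 *v d) = 0 \<Longrightarrow>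
       0 \<le> 2 * (p \<bullet> d) + d \<bullet> (A0 *v d)"
    and gv: "g \<bullet> v = 0" and Av: "v \<bullet> (A1 *v v) = 0"
  shows "p \<bullet> v = 0" and "0 \<le> v \<bullet> (A0 *v v)"
proof -
  let ?a = "v \<bullet> (A0 *v v)"
  have small: "eventually (\<lambda>t. norm (t *\<^sub>R v) < e) (at (0::real))"
  proof -
    have "((\<lambda>t. norm (t *\<^sub>R v)) \<longlongrightarrow> norm (0 *\<^sub>R v)) (at (0::real))"
      by (intro tendsto_intros)
    then show ?thesis using e by (simp add: order_tendsto_iff)
  qed
  have ev: "eventually (\<lambda>t. 0 \<le> t * (2 * (p \<bullet> v) + t * ?a)) (at (0::real))"
    using small
  proof eventually_elim
    case (elim t)
    have "0 \<le> 2 * (p \<bullet> (t *\<^sub>R v)) + (t *\<^sub>R v) \<bullet> (A0 *v (t *\<^sub>R v))"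
      by (rule min[OF elim]) (simp add: gv Av matrix_vector_mult_scaleR)
    then show ?case by (simp add: matrix_vector_mult_scaleR algebra_simps)
  qed
  have lim: "((\<lambda>t. 2 * (p \<bullet> v) + t * ?a) \<longlongrightarrow> 2 * (p \<bullet> v) + 0 * ?a) (at (0::real) within S)" for S
    by (intro tendsto_intros)
  have "0 \<le> 2 * (p \<bullet> v) + 0 * ?a"
  proof (rule tendsto_lowerbound[OF lim])
    show "eventually (\<lambda>t. 0 \<le> 2 * (p \<bullet> v) + t * ?a) (at_right (0::real))"
      using ev unfolding eventually_at_split eventually_at_filter
      by (auto elim!: eventually_mono simp: zero_le_mult_iff)
  qed simp
  moreover have "2 * (p \<bullet> v) + 0 * ?a \<le> 0"
  proof (rule tendsto_upperbound[OF lim])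
    show "eventually (\<lambda>t. 2 * (p \<bullet> v) + t * ?a \<le> 0) (at_left (0::real))"
      using ev unfolding eventually_at_split eventually_at_filter
      by (auto elim!: eventually_mono simp: zero_le_mult_iff)
  qed simp
  ultimately show pv: "p \<bullet> v = 0" by simp
  obtain t :: real where "t \<noteq> 0" "0 \<le> t * (2 * (p \<bullet> v) + t * ?a)"
  proof -
    have "eventually (\<lambda>t. t \<noteq> 0 \<and> 0 \<le> t * (2 * (p \<bullet> v) + t * ?a)) (at (0::real))"
      using ev by (auto simp: eventually_conj_iff eventually_neq_at_within)
    then show ?thesis using that eventually_happens at_neq_bot by blast
  qed
  then have "0 \<le> (t * t) * ?a" by (simp add: pv algebra_simps)
  then show "0 \<le> ?a" using \<open>t \<noteq> 0\<close>
    by (metis mult_le_0_iff not_square_less_zero zero_le_mult_iff mult_eq_0_iff order_antisym)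
qed

text \<open>For a tangent vector \<open>v\<close> with \<open>v \<bullet> A1 v \<noteq> 0\<close>, the line in the slightly tilted
  direction \<open>w = v + \<epsilon> g\<close> meets the quadric in a second point \<open>x + t w\<close>, where
  \<open>t = - 2 \<epsilon> (g \<bullet> g) / (w \<bullet> A1 w)\<close>. As \<open>\<epsilon>\<close> tends to \<open>0\<close>, these points trace a curve in the quadric
  through \<open>x\<close> with tangent \<open>v\<close>. Since \<open>t\<close> changes
  sign with \<open>\<epsilon>\<close>, the first-order condition follows; and on the quadric the objective
  agrees with the Lagrangian, which gives the second-order condition.\<close>

lemma local_minimizer_along_curve:
  fixes p v g :: "real^'n" and A0 A1 :: "real^'n^'n"
  assumes e: "e > 0"
    and min: "\<And>d. norm d < e \<Longrightarrow> 2 * (g \<bullet> d) + d \<bullet> (A1 *v d) = 0 \<Longrightarrow>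
       0 \<le> 2 * (p \<bullet> d) + d \<bullet> (A0 *v d)"
    and g: "g \<noteq> 0" and gv: "g \<bullet> v = 0" and Av: "v \<bullet> (A1 *v v) \<noteq> 0"
  shows "p \<bullet> v = 0"
    and "p + \<mu> *\<^sub>R g = 0 \<Longrightarrow> 0 \<le> v \<bullet> (A0 *v v) + \<mu> * (v \<bullet> (A1 *v v))"
proof -
  define w where "w s = v + s *\<^sub>R g" for s :: real
  define k where "k s = - 2 * (g \<bullet> g) / (w s \<bullet> (A1 *v w s))" for s :: real
  define t where "t s = s * k s" for s :: real
  have wlim: "(w \<longlongrightarrow> v) (at 0 within S)" for S
    unfolding w_def by (rule tendsto_eq_intros refl | simp)+
  have qlim: "((\<lambda>s. w s \<bullet> (A *v w s)) \<longlongrightarrow> v \<bullet> (A *v v)) (at 0 within S)"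
    for S and A :: "real^'n^'n"
    by (intro tendsto_inner wlim bounded_linear.tendsto[OF matrix_vector_mul_bounded_linear])
  have klim: "(k \<longlongrightarrow> - 2 * (g \<bullet> g) / (v \<bullet> (A1 *v v))) (at 0 within S)" for S
    unfolding k_def by (intro tendsto_intros qlim Av)
  have tlim: "(t \<longlongrightarrow> 0) (at 0 within S)" for S
    unfolding t_def by (rule tendsto_eq_intros klim refl | simp)+
  have small: "eventually (\<lambda>s. norm (t s *\<^sub>R w s) < e) (at 0)"
  proof -
    have "((\<lambda>s. norm (t s *\<^sub>R w s)) \<longlongrightarrow> norm (0 *\<^sub>R v)) (at 0)"
      by (intro tendsto_intros tlim wlim)
    then show ?thesis using e by (simp add: order_tendsto_iff)
  qed
  have nz: "eventually (\<lambda>s. w s \<bullet> (A1 *v w s) \<noteq> 0) (at 0)"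
    by (rule tendsto_imp_eventually_ne[OF qlim Av])
  have feas: "2 * (g \<bullet> (t s *\<^sub>R w s)) + (t s *\<^sub>R w s) \<bullet> (A1 *v (t s *\<^sub>R w s)) = 0"
    if "w s \<bullet> (A1 *v w s) \<noteq> 0" for s
  proof -
    have "g \<bullet> w s = s * (g \<bullet> g)" by (simp add: w_def inner_add_right gv)
    moreover have "t s * (w s \<bullet> (A1 *v w s)) = - 2 * s * (g \<bullet> g)"
      using that by (simp add: t_def k_def)
    ultimately show ?thesis by (simp add: matrix_vector_mult_scaleR)
  qed
  have ev: "eventually (\<lambda>s. 0 \<le> s * (k s * (2 * (p \<bullet> w s) + t s * (w s \<bullet> (A0 *v w s))))) (at 0)"
    using small nz
  proof eventually_elim
    case (elim s)
    have "0 \<le> 2 * (p \<bullet> (t s *\<^sub>R w s)) + (t s *\<^sub>R w s) \<bullet> (A0 *v (t s *\<^sub>R w s))"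
      by (rule min[OF elim(1) feas[OF elim(2)]])
    also have "\<dots> = t s * (2 * (p \<bullet> w s) + t s * (w s \<bullet> (A0 *v w s)))"
      by (simp add: matrix_vector_mult_scaleR algebra_simps)
    finally show ?case by (simp add: t_def mult.assoc)
  qed
  let ?K = "- 2 * (g \<bullet> g) / (v \<bullet> (A1 *v v))"
  have lim: "((\<lambda>s. k s * (2 * (p \<bullet> w s) + t s * (w s \<bullet> (A0 *v w s))))
      \<longlongrightarrow> ?K * (2 * (p \<bullet> v) + 0 * (v \<bullet> (A0 *v v)))) (at 0 within S)" for S
    by (intro tendsto_intros klim wlim tlim qlim)
  have "0 \<le> ?K * (2 * (p \<bullet> v) + 0 * (v \<bullet> (A0 *v v)))"
  proof (rule tendsto_lowerbound[OF lim])
    show "eventually (\<lambda>s. 0 \<le> k s * (2 * (p \<bullet> w s) + t s * (w s \<bullet> (A0 *v w s)))) (at_right 0)"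
      using ev unfolding eventually_at_split eventually_at_filter
      by (auto elim!: eventually_mono simp: zero_le_mult_iff[of _ "k _ * _"])
  qed simp
  moreover have "?K * (2 * (p \<bullet> v) + 0 * (v \<bullet> (A0 *v v))) \<le> 0"
  proof (rule tendsto_upperbound[OF lim])
    show "eventually (\<lambda>s. k s * (2 * (p \<bullet> w s) + t s * (w s \<bullet> (A0 *v w s))) \<le> 0) (at_left 0)"
      using ev unfolding eventually_at_split eventually_at_filter
      by (auto elim!: eventually_mono simp: zero_le_mult_iff[of _ "k _ * _"])
  qed simp
  ultimately have "?K * (2 * (p \<bullet> v)) = 0" by simp
  then show "p \<bullet> v = 0" using g Av by auto
  assume "p + \<mu> *\<^sub>R g = 0"
  then have p: "p = - (\<mu> *\<^sub>R g)" by (simp add: eq_neg_iff_add_eq_0)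
  have k0: "?K \<noteq> 0" using g Av by auto
  have "eventually (\<lambda>s. 0 \<le> w s \<bullet> (A0 *v w s) + \<mu> * (w s \<bullet> (A1 *v w s))) (at 0)"
    using small nz tendsto_imp_eventually_ne[OF klim k0] eventually_neq_at_within[of 0]
  proof eventually_elim
    case (elim s)
    let ?d = "t s *\<^sub>R w s"
    have "0 \<le> 2 * (p \<bullet> ?d) + ?d \<bullet> (A0 *v ?d)"
      by (rule min[OF elim(1) feas[OF elim(2)]])
    also have "\<dots> = ?d \<bullet> (A0 *v ?d) + \<mu> * (?d \<bullet> (A1 *v ?d))"
    proof -
      have "p \<bullet> ?d = - (\<mu> * (g \<bullet> ?d))" by (simp add: p)
      moreover have "2 * (g \<bullet> ?d) = - (?d \<bullet> (A1 *v ?d))" using feas[OF elim(2)] by linarith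
      ultimately show ?thesis by (simp add: algebra_simps)
    qed
    also have "\<dots> = (t s)\<^sup>2 * (w s \<bullet> (A0 *v w s) + \<mu> * (w s \<bullet> (A1 *v w s)))"
      by (simp add: matrix_vector_mult_scaleR power2_eq_square algebra_simps)
    finally have "0 \<le> (t s)\<^sup>2 * (w s \<bullet> (A0 *v w s) + \<mu> * (w s \<bullet> (A1 *v w s)))" .
    moreover have "0 < (t s)\<^sup>2" using elim(3,4) by (simp add: t_def)
    ultimately show ?case by (simp add: zero_le_mult_iff)
  qed
  moreover have "((\<lambda>s. w s \<bullet> (A0 *v w s) + \<mu> * (w s \<bullet> (A1 *v w s)))
      \<longlongrightarrow> v \<bullet> (A0 *v v) + \<mu> * (v \<bullet> (A1 *v v))) (at 0)"
    by (intro tendsto_intros qlim)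
  ultimately show "0 \<le> v \<bullet> (A0 *v v) + \<mu> * (v \<bullet> (A1 *v v))"
    by (intro tendsto_lowerbound) auto
qed

section \<open>Multipliers of local-nonglobal minimizers\<close>

definition saddle_multiplier ::
  "real^'n^'n \<Rightarrow> real^'n \<Rightarrow> real^'n^'n \<Rightarrow> real^'n \<Rightarrow> real^'n \<Rightarrow> real \<Rightarrow> bool" where
  "saddle_multiplier A0 b0 A1 b1 x \<mu> \<longleftrightarrow>
     (A0 *v x + b0) + \<mu> *\<^sub>R (A1 *v x + b1) = 0 \<and>
     (\<forall>v. (A1 *v x + b1) \<bullet> v = 0 \<longrightarrow> 0 \<le> v \<bullet> (A0 *v v) + \<mu> * (v \<bullet> (A1 *v v))) \<and>
     (\<exists>u. u \<bullet> (A0 *v u) + \<mu> * (u \<bullet> (A1 *v u)) < 0)"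

lemma saddle_multiplier_uminus:
  assumes "saddle_multiplier A0 b0 A1 b1 x \<mu>"
  shows "saddle_multiplier A0 b0 (- A1) (- b1) x (- \<mu>)"
proof -
  have "(- A1) *v x + - b1 = - (A1 *v x + b1)" by (simp add: uminus_matrix_vector)
  then show ?thesis
    using assms unfolding saddle_multiplier_def
    by (auto simp only: inner_uminus_matrix inner_minus_left neg_equal_0_iff_equal scaleR_minus_left
        scaleR_minus_right minus_mult_minus minus_minus simp_thms)
qed

lemma local_nonglobal_minimizer_saddle_multiplier:
  fixes A0 A1 :: "real^'n^'n"
  assumes s0: "symmetric_matrix A0" and s1: "symmetric_matrix A1"
    and pd: "\<And>u. u \<noteq> 0 \<Longrightarrow> 0 < u \<bullet> (A0 *v u) + \<kappa> * (u \<bullet> (A1 *v u))"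
    and lng: "local_nonglobal_minimizer (quad_fun A0 b0 c0) {x. quad_fun A1 b1 c1 x = 0} x"
  obtains \<mu> where "saddle_multiplier A0 b0 A1 b1 x \<mu>"
proof -
  define p where "p = A0 *v x + b0"
  define g where "g = A1 *v x + b1"
  have lm: "local_minimizer (quad_fun A0 b0 c0) {x. quad_fun A1 b1 c1 x = 0} x"
    and fx: "quad_fun A1 b1 c1 x = 0"
    using lng by (auto simp: local_nonglobal_minimizer_def local_minimizer_def)
  obtain y where fy: "quad_fun A1 b1 c1 y = 0"
    and lt: "quad_fun A0 b0 c0 y < quad_fun A0 b0 c0 x"
    using lng fx
    by (auto simp: local_nonglobal_minimizer_def global_minimizer_def not_le)
  obtain e where e: "e > 0"
    and min: "\<And>d. norm d < e \<Longrightarrow> 2 * (g \<bullet> d) + d \<bullet> (A1 *v d) = 0 \<Longrightarrow>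
       0 \<le> 2 * (p \<bullet> d) + d \<bullet> (A0 *v d)"
    using local_minimizer_displacement[OF s0 s1 lm] unfolding p_def g_def by metis
  define d where "d = y - x"
  have y: "y = x + d" by (simp add: d_def)
  have feas: "2 * (g \<bullet> d) + d \<bullet> (A1 *v d) = 0"
    using fy fx unfolding y quad_fun_add[OF s1] g_def by simp
  have neg: "2 * (p \<bullet> d) + d \<bullet> (A0 *v d) < 0"
    using lt unfolding y quad_fun_add[OF s0] p_def by simp
  have g0: "g \<noteq> 0"
  proof
    assume "g = 0"
    then have "g \<bullet> d = 0" "d \<bullet> (A1 *v d) = 0" using feas by simp_all
    then have "p \<bullet> d = 0" "0 \<le> d \<bullet> (A0 *v d)"
      using local_minimizer_along_line[OF e min] by blast+
    then show False using neg by simp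
  qed
  have tangent: "p \<bullet> v = 0" if "g \<bullet> v = 0" for v
    using local_minimizer_along_line(1)[OF e min that] local_minimizer_along_curve(1)[OF e min g0 that]
    by blast
  \<comment> \<open>The component of \<open>p\<close> orthogonal to \<open>g\<close> is a tangent vector, hence orthogonal to itself.\<close>
  define \<mu> where "\<mu> = - (p \<bullet> g) / (g \<bullet> g)"
  have orth: "g \<bullet> (p + \<mu> *\<^sub>R g) = 0"
    using g0 by (simp only: inner_add_right inner_scaleR_right) (simp add: \<mu>_def inner_commute)
  have "(p + \<mu> *\<^sub>R g) \<bullet> (p + \<mu> *\<^sub>R g) = 0"
    using orth tangent[OF orth] by (simp add: inner_add_left)
  then have stat: "p + \<mu> *\<^sub>R g = 0" by simp
  have psd: "0 \<le> v \<bullet> (A0 *v v) + \<mu> * (v \<bullet> (A1 *v v))" if "g \<bullet> v = 0" for v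
    using local_minimizer_along_line(2)[OF e min that]
      local_minimizer_along_curve(2)[OF e min g0 that _ stat]
    by (cases "v \<bullet> (A1 *v v) = 0") auto
  have "p \<bullet> d = - (\<mu> * (g \<bullet> d))"
    using stat by (metis eq_neg_iff_add_eq_0 inner_minus_left inner_scaleR_left)
  moreover have "2 * (g \<bullet> d) = - (d \<bullet> (A1 *v d))" using feas by linarith
  ultimately have "2 * (p \<bullet> d) = \<mu> * (d \<bullet> (A1 *v d))" by (simp add: algebra_simps)
  then have "d \<bullet> (A0 *v d) + \<mu> * (d \<bullet> (A1 *v d)) < 0" using neg by simp
  then show ?thesis
    using that stat psd unfolding saddle_multiplier_def p_def g_def by blast
qed

section \<open>Uniqueness on each side of a definite pencil member\<close>

text \<open>The feasibility equations at \<open>x\<close> and \<open>x + d\<close> together say that \<open>d\<close> is a null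
  vector of the average of the two Hessians. As this average lies above \<open>\<kappa>\<close> in the pencil,
  \<open>A1\<close> is negative at \<open>d\<close>, which fixes all the signs used below.\<close>

lemma saddle_multiplier_unique_above_le:
  fixes A0 A1 :: "real^'n^'n"
  assumes s0: "symmetric_matrix A0" and s1: "symmetric_matrix A1"
    and pd: "\<And>u. u \<noteq> 0 \<Longrightarrow> 0 < u \<bullet> (A0 *v u) + \<kappa> * (u \<bullet> (A1 *v u))"
    and fx: "quad_fun A1 b1 c1 x = 0" and fy: "quad_fun A1 b1 c1 y = 0"
    and mx: "saddle_multiplier A0 b0 A1 b1 x \<mu>" and my: "saddle_multiplier A0 b0 A1 b1 y \<nu>"
    and \<mu>: "\<kappa> < \<mu>" and le: "\<mu> \<le> \<nu>"
  shows "x = y"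
proof (rule ccontr)
  assume "x \<noteq> y"
  define d where "d = y - x"
  define g where "g = A1 *v x + b1"
  define h where "h = A1 *v y + b1"
  define q0 where "q0 u = u \<bullet> (A0 *v u)" for u :: "real^'n"
  define q1 where "q1 u = u \<bullet> (A1 *v u)" for u :: "real^'n"
  have d0: "d \<noteq> 0" and y: "y = x + d" using \<open>x \<noteq> y\<close> by (simp_all add: d_def)
  have h: "h = g + A1 *v d"
    by (simp add: h_def g_def y matrix_vector_right_distrib)
  have statx: "(A0 *v x + b0) + \<mu> *\<^sub>R g = 0" and staty: "(A0 *v y + b0) + \<nu> *\<^sub>R h = 0"
    and psdx: "\<And>v. g \<bullet> v = 0 \<Longrightarrow> 0 \<le> q0 v + \<mu> * q1 v"
    and psdy: "\<And>v. h \<bullet> v = 0 \<Longrightarrow> 0 \<le> q0 v + \<nu> * q1 v"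
    using mx my unfolding saddle_multiplier_def g_def h_def q0_def q1_def by auto
  obtain u where u: "q0 u + \<mu> * q1 u < 0"
    using mx unfolding saddle_multiplier_def q0_def q1_def by blast
  have "A0 *v d + \<nu> *\<^sub>R h - \<mu> *\<^sub>R g = ((A0 *v y + b0) + \<nu> *\<^sub>R h) - ((A0 *v x + b0) + \<mu> *\<^sub>R g)"
    by (simp add: y matrix_vector_right_distrib)
  then have diff: "A0 *v d + \<nu> *\<^sub>R h - \<mu> *\<^sub>R g = 0" using statx staty by simp
  have Hd: "A0 *v d + \<mu> *\<^sub>R (A1 *v d) = - ((\<nu> - \<mu>) *\<^sub>R h)"
    using diff unfolding h by (simp add: algebra_simps eq_neg_iff_add_eq_0)
  have Hdv: "v \<bullet> (A0 *v d) + \<mu> * (v \<bullet> (A1 *v d)) = - ((\<nu> - \<mu>) * (h \<bullet> v))" for v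
    using arg_cong[OF Hd, of "\<lambda>z. v \<bullet> z"] by (simp add: inner_add_right inner_commute)
  have "2 * (g \<bullet> d) + q1 d = 0"
    using fx fy unfolding y quad_fun_add[OF s1] g_def q1_def by simp
  moreover have "h \<bullet> d = g \<bullet> d + q1 d"
    by (simp add: h q1_def inner_add_left inner_commute[of d])
  ultimately have gd: "2 * (g \<bullet> d) = - q1 d" and hd: "2 * (h \<bullet> d) = q1 d" by linarith+
  have dHd: "2 * (q0 d + \<mu> * q1 d) = - ((\<nu> - \<mu>) * q1 d)"
  proof -
    have "q0 d + \<mu> * q1 d = - ((\<nu> - \<mu>) * (h \<bullet> d))"
      using Hdv[of d] by (simp add: q0_def q1_def)
    also have "2 * \<dots> = - ((\<nu> - \<mu>) * (2 * (h \<bullet> d)))" by simp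
    finally show ?thesis unfolding hd .
  qed
  have neg: "q1 d < 0"
  proof -
    have "0 < q0 d + \<kappa> * q1 d" using pd[OF d0] by (simp add: q0_def q1_def)
    then have "0 < - ((\<nu> + \<mu> - 2 * \<kappa>) * q1 d)"
      using dHd by (simp add: algebra_simps)
    moreover have "0 < \<nu> + \<mu> - 2 * \<kappa>" using \<mu> le by simp
    ultimately show ?thesis by (simp add: mult_less_0_iff)
  qed
  \<comment> \<open>In the Hessian form at \<open>x\<close>, the product of \<open>d\<close> with \<open>v\<close> is a multiple of \<open>h \<bullet> v\<close>.\<close>
  have expand: "q0 (v - a *\<^sub>R d) + \<mu> * q1 (v - a *\<^sub>R d) =
      q0 v + \<mu> * q1 v + 2 * a * ((\<nu> - \<mu>) * (h \<bullet> v)) + a * a * (q0 d + \<mu> * q1 d)" for v a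
  proof -
    have e: "(v - a *\<^sub>R d) \<bullet> (A *v (v - a *\<^sub>R d)) =
        v \<bullet> (A *v v) - 2 * a * (v \<bullet> (A *v d)) + a * a * (d \<bullet> (A *v d))"
      if "symmetric_matrix A" for A
      using symmetric_matrix_inner_commute[OF that, of d v]
      by (simp add: matrix_vector_mult_diff_distrib matrix_vector_mult_scaleR inner_diff_left
          inner_diff_right algebra_simps)
    have "q0 (v - a *\<^sub>R d) + \<mu> * q1 (v - a *\<^sub>R d) = q0 v + \<mu> * q1 v
        - 2 * a * (v \<bullet> (A0 *v d) + \<mu> * (v \<bullet> (A1 *v d))) + a * a * (q0 d + \<mu> * q1 d)"
      unfolding q0_def q1_def e[OF s0] e[OF s1] by (simp add: algebra_simps)
    then show ?thesis unfolding Hdv by simp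
  qed
  show False
  proof (cases "\<mu> = \<nu>")
    case True
    \<comment> \<open>Shift the direction of negative curvature along the kernel vector \<open>d\<close> into the tangent
      space at \<open>x\<close>.\<close>
    define a where "a = (g \<bullet> u) / (g \<bullet> d)"
    have "g \<bullet> d \<noteq> 0" using gd neg by auto
    then have "g \<bullet> (u - a *\<^sub>R d) = 0" by (simp add: a_def inner_diff_right)
    then have "0 \<le> q0 (u - a *\<^sub>R d) + \<mu> * q1 (u - a *\<^sub>R d)" by (rule psdx)
    also have "\<dots> = q0 u + \<mu> * q1 u" using expand[of u a] dHd True by simp
    finally show False using u by simp
  next
    case False
    then have \<delta>: "0 < \<nu> - \<mu>" using le by simp
    have pos: "0 < q0 d + \<mu> * q1 d"
    proof -
      have "0 < 2 * (q0 d + \<mu> * q1 d)"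
        unfolding dHd using mult_pos_neg[OF \<delta> neg] by simp
      then show ?thesis by (simp only: zero_less_mult_iff) simp
    qed
    have hd0: "h \<bullet> d \<noteq> 0" using hd neg by auto
    define a where "a = (h \<bullet> u) / (h \<bullet> d)"
    define w where "w = u - a *\<^sub>R d"
    have hw: "h \<bullet> w = 0" using hd0 by (simp add: w_def a_def inner_diff_right)
    \<comment> \<open>\<open>u = w + a d\<close> is an orthogonal decomposition for the Hessian form at \<open>x\<close>.\<close>
    have "q0 u + \<mu> * q1 u = q0 w + \<mu> * q1 w + a * a * (q0 d + \<mu> * q1 d)"
      using expand[of w "- a"] hw by (simp add: w_def)
    moreover have "0 \<le> a * a * (q0 d + \<mu> * q1 d)" using pos by simp
    ultimately have wneg: "q0 w + \<mu> * q1 w < 0" using u by linarith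
    then have "w \<noteq> 0" by (auto simp: q0_def q1_def)
    then have wk: "0 < q0 w + \<kappa> * q1 w" using pd by (simp add: q0_def q1_def)
    have "0 < (\<nu> - \<mu>) * q1 w" using psdy[OF hw] wneg by (simp add: algebra_simps)
    then have "0 < q1 w" using \<delta> by (simp add: zero_less_mult_iff)
    then have "\<kappa> * q1 w < \<mu> * q1 w" using \<mu> by simp
    then show False using wk wneg by linarith
  qed
qed

lemma saddle_multiplier_unique_above:
  fixes A0 A1 :: "real^'n^'n"
  assumes "symmetric_matrix A0" and "symmetric_matrix A1"
    and "\<And>u. u \<noteq> 0 \<Longrightarrow> 0 < u \<bullet> (A0 *v u) + \<kappa> * (u \<bullet> (A1 *v u))"
    and "quad_fun A1 b1 c1 x = 0" and "quad_fun A1 b1 c1 y = 0"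
    and "saddle_multiplier A0 b0 A1 b1 x \<mu>" and "saddle_multiplier A0 b0 A1 b1 y \<nu>"
    and "\<kappa> < \<mu>" and "\<kappa> < \<nu>"
  shows "x = y"
proof (cases "\<mu> \<le> \<nu>")
  case True
  show ?thesis by (rule saddle_multiplier_unique_above_le[OF assms(1-8) True])
next
  case False
  then show ?thesis
    using saddle_multiplier_unique_above_le[OF assms(1-3,5,4,7,6,9)] by simp
qed

lemma saddle_multiplier_unique_below:
  fixes A0 A1 :: "real^'n^'n"
  assumes "symmetric_matrix A0" and "symmetric_matrix A1"
    and "\<And>u. u \<noteq> 0 \<Longrightarrow> 0 < u \<bullet> (A0 *v u) + \<kappa> * (u \<bullet> (A1 *v u))"
    and "quad_fun A1 b1 c1 x = 0" and "quad_fun A1 b1 c1 y = 0"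
    and "saddle_multiplier A0 b0 A1 b1 x \<mu>" and "saddle_multiplier A0 b0 A1 b1 y \<nu>"
    and "\<mu> < \<kappa>" and "\<nu> < \<kappa>"
  shows "x = y"
proof (rule saddle_multiplier_unique_above[where \<kappa> = "- \<kappa>"])
  show "saddle_multiplier A0 b0 (- A1) (- b1) x (- \<mu>)"
    and "saddle_multiplier A0 b0 (- A1) (- b1) y (- \<nu>)"
    using assms by (simp_all add: saddle_multiplier_uminus)
  show "quad_fun (- A1) (- b1) (- c1) x = 0" and "quad_fun (- A1) (- b1) (- c1) y = 0"
    using assms by (simp_all add: quad_fun_uminus)
qed (use assms in \<open>simp_all add: symmetric_matrix_uminus inner_uminus_matrix\<close>)

section \<open>Counting local-nonglobal minimizers\<close>

lemma has_at_most_1I: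
  assumes "\<And>x y. x \<in> S \<Longrightarrow> y \<in> S \<Longrightarrow> x = y"
  shows "has_at_most 1 S"
proof (cases "S = {}")
  case False
  then obtain x where "x \<in> S" by blast
  then have "S = {x}" using assms by blast
  then show ?thesis by (simp add: has_at_most_def)
qed (simp add: has_at_most_def)

lemma has_at_most_subset:
  assumes "has_at_most k T" and "S \<subseteq> T"
  shows "has_at_most k S"
  using assms unfolding has_at_most_def by (meson card_mono finite_subset order_trans)

lemma has_at_most_Un:
  assumes "has_at_most j S" and "has_at_most k T"
  shows "has_at_most (j + k) (S \<union> T)"
  using assms card_Un_le[of S T] unfolding has_at_most_def by auto

theorem theorem3p10:
  fixes A0 A1 :: "real^'n^'n" and b0 b1 :: "real^'n" and c1 :: real
  assumes "symmetric_matrix A0" and "symmetric_matrix A1"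
    and "\<exists>\<mu>1::real. positive_definite (A0 + \<mu>1 *\<^sub>R A1)"
  shows "(positive_semidefinite A1 \<or> negative_semidefinite A1 \<longrightarrow>
            has_at_most 1 (gtre_local_nonglobal_minimizers A0 b0 A1 b1 c1)) \<and>
         (indefinite A1 \<longrightarrow>
            has_at_most 2 (gtre_local_nonglobal_minimizers A0 b0 A1 b1 c1))"
proof -
  obtain \<kappa> where \<kappa>: "positive_definite (A0 + \<kappa> *\<^sub>R A1)" using assms(3) by blast
  have pd: "0 < u \<bullet> (A0 *v u) + \<kappa> * (u \<bullet> (A1 *v u))" if "u \<noteq> 0" for u
    using \<kappa> that unfolding positive_definite_def
    by (simp add: matrix_vector_mult_add_rdistrib scaleR_matrix_vector_assoc[symmetric]
        inner_add_right)
  let ?S = "gtre_local_nonglobal_minimizers A0 b0 A1 b1 c1"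
  let ?above = "{x \<in> ?S. \<exists>\<mu>>\<kappa>. saddle_multiplier A0 b0 A1 b1 x \<mu>}"
  let ?below = "{x \<in> ?S. \<exists>\<mu><\<kappa>. saddle_multiplier A0 b0 A1 b1 x \<mu>}"
  have feas: "quad_fun A1 b1 c1 x = 0" if "x \<in> ?S" for x
    using that by (auto simp: gtre_local_nonglobal_minimizers_def local_nonglobal_minimizer_def
        local_minimizer_def gtre_feasible_def)
  have above1: "has_at_most 1 ?above"
    by (rule has_at_most_1I) (use saddle_multiplier_unique_above[OF assms(1,2) pd] feas in blast)
  have below1: "has_at_most 1 ?below"
    by (rule has_at_most_1I) (use saddle_multiplier_unique_below[OF assms(1,2) pd] feas in blast)
  have mult: "\<exists>\<mu>. saddle_multiplier A0 b0 A1 b1 x \<mu>" if "x \<in> ?S" for x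
    using that local_nonglobal_minimizer_saddle_multiplier[OF assms(1,2) pd, of b0 0 b1 c1 x]
    unfolding gtre_local_nonglobal_minimizers_def gtre_objective_def gtre_feasible_def by blast
  \<comment> \<open>At a direction \<open>u\<close> of negative curvature the pencil passes from a positive value at \<open>\<kappa>\<close> to a
    negative one at \<open>\<mu>\<close>.\<close>
  have sign: "\<exists>u. (\<mu> - \<kappa>) * (u \<bullet> (A1 *v u)) < 0" if "saddle_multiplier A0 b0 A1 b1 x \<mu>" for x \<mu>
  proof -
    obtain u where u: "u \<bullet> (A0 *v u) + \<mu> * (u \<bullet> (A1 *v u)) < 0"
      using \<open>saddle_multiplier A0 b0 A1 b1 x \<mu>\<close> unfolding saddle_multiplier_def by blast
    then have "u \<noteq> 0" by auto
    then show ?thesis using pd[of u] u by (intro exI[of _ u]) (simp add: left_diff_distrib)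
  qed
  have split: "?S \<subseteq> ?above \<union> ?below"
  proof -
    have "x \<in> ?above \<union> ?below" if x: "x \<in> ?S" for x
    proof -
      obtain \<mu> where \<mu>: "saddle_multiplier A0 b0 A1 b1 x \<mu>" using mult[OF x] by blast
      then have "\<mu> \<noteq> \<kappa>" using sign by fastforce
      then show ?thesis using x \<mu> by (auto simp: neq_iff)
    qed
    then show ?thesis by blast
  qed
  show ?thesis
  proof (intro conjI impI)
    assume "positive_semidefinite A1 \<or> negative_semidefinite A1"
    then show "has_at_most 1 ?S"
    proof
      assume "positive_semidefinite A1"
      have "\<not> saddle_multiplier A0 b0 A1 b1 x \<mu>" if "\<kappa> < \<mu>" for x \<mu>
      proof
        assume "saddle_multiplier A0 b0 A1 b1 x \<mu>"
        then obtain u where "(\<mu> - \<kappa>) * (u \<bullet> (A1 *v u)) < 0" using sign by blast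
        moreover have "0 \<le> u \<bullet> (A1 *v u)"
          using \<open>positive_semidefinite A1\<close> by (simp add: positive_semidefinite_def)
        ultimately show False using that by (auto simp: mult_less_0_iff)
      qed
      then have "?above = {}" by blast
      then have "?S \<subseteq> ?below" using split by fast
      then show ?thesis by (rule has_at_most_subset[OF below1])
    next
      assume "negative_semidefinite A1"
      have "\<not> saddle_multiplier A0 b0 A1 b1 x \<mu>" if "\<mu> < \<kappa>" for x \<mu>
      proof
        assume "saddle_multiplier A0 b0 A1 b1 x \<mu>"
        then obtain u where "(\<mu> - \<kappa>) * (u \<bullet> (A1 *v u)) < 0" using sign by blast
        moreover have "u \<bullet> (A1 *v u) \<le> 0"
          using \<open>negative_semidefinite A1\<close> by (simp add: negative_semidefinite_def)
        ultimately show False using that by (auto simp: mult_less_0_iff)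
      qed
      then have "?below = {}" by blast
      then have "?S \<subseteq> ?above" using split by fast
      then show ?thesis by (rule has_at_most_subset[OF above1])
    qed
  next
    show "has_at_most 2 ?S"
      by (rule has_at_most_subset[OF _ split])
        (use has_at_most_Un[OF above1 below1] in \<open>simp only: one_add_one\<close>)
  qed
qed

end
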